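(* Let $X$ be a metric space with metric $d$. Suppose that for all $R>0$ and $\varepsilon>0$ there is a partition of unity $(\varphi_i)_{i\in I}$ on $X$ such that (i) for all $x,y\in X$ with $d(x,y)\leq R$ one has $\sum_{i\in I}|\varphi_i(x)-\varphi_i(y)|\leq\varepsilon$; and (ii) $(\varphi_i)_{i\in I}$ is subordinated to an equi-exact cover $(U_i)_{i\in I}$ of $X$ (each $U_i$ carrying the metric induced from $X$). Then $X$ is exact.
   Context: Partition of unity: for a set $X$, a partition of unity on $X$ is a family of maps $(\varphi_i)_{i\in I}$, $\varphi_i:X\to[0,1]$, with $\sum_{i\in I}\varphi_i(x)=1$ for all $x\in X$ (for given $x$, the set $\{i:\varphi_i(x)\neq0\}$ is not required to be finite). It is subordinated to a cover $(U_i)_{i\in I}$ of $X$ if each $\varphi_i$ vanishes outside $U_i$. Exact: a metric space $X$ is exact if for all $R>0$ and $\varepsilon>0$ there is a partition of unity $(\varphi_i)_{i\in I}$ on $X$ subordinated to a cover $(U_i)_{i\in I}$ such that (1) $\sum_{i\in I}|\varphi_i(x)-\varphi_i(y)|\leq\varepsilon$ for all $x,y\in X$ with $d(x,y)\leq R$, and (2) the cover is uniformly bounded, i.e. $\sup_{i\in I}\mathrm{diam}(U_i)<\infty$. Equi-exact: a family of metric spaces $(X_i)_{i\in I}$ is equi-exact if for all $R>0$ and $\varepsilon>0$ and for every $i\in I$ there is a partition of unity $(\psi_i^j)_{j\in J_i}$ on $X_i$ subordinated to a cover $(U_i^j)_{j\in J_i}$ of $X_i$ such that (1) for all $i\in I$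 and all $x,y\in X_i$ with $d(x,y)\leq R$, $\sum_{j\in J_i}|\psi_i^j(x)-\psi_i^j(y)|\leq\varepsilon$, and (2) $\sup_{i\in I,\,j\in J_i}\mathrm{diam}(U_i^j)<\infty$. *)

theory Defs
  imports "HOL-Analysis.Analysis"
begin

definition partition_of_unity :: "'a set \<Rightarrow> 'i set \<Rightarrow> ('i \<Rightarrow> 'a \<Rightarrow> real) \<Rightarrow> bool" where
  "partition_of_unity X I \<phi> \<longleftrightarrow>
     (\<forall>i\<in>I. \<phi> i \<in> X \<rightarrow> {0..1}) \<and> (\<forall>x\<in>X. ((\<lambda>i. \<phi> i x) has_sum 1) I)"

definition covers :: "'a set \<Rightarrow> 'i set \<Rightarrow> ('i \<Rightarrow> 'a set) \<Rightarrow> bool" where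
  "covers X I U \<longleftrightarrow> (\<Union>i\<in>I. U i) = X"

definition subordinated :: "'a set \<Rightarrow> 'i set \<Rightarrow> ('i \<Rightarrow> 'a \<Rightarrow> real) \<Rightarrow> ('i \<Rightarrow> 'a set) \<Rightarrow> bool" where
  "subordinated X I \<phi> U \<longleftrightarrow> (\<forall>i\<in>I. \<forall>x\<in>X - U i. \<phi> i x = 0)"

text \<open>The diameter takes values in \<^typ>\<open>ennreal\<close>, so that unbounded sets have diameter
  \<^term>\<open>\<infinity> :: ennreal\<close>; the real-valued \<^const>\<open>diameter\<close> carries no information on them.\<close>

definition mdiameter :: "'a metric \<Rightarrow> 'a set \<Rightarrow> ennreal" where
  "mdiameter m S = (SUP (x, y)\<in>S \<times> S. ennreal (mdist m x y))"

text \<open>In both definitions below the partitions are indexed by subsets of the type \<^typ>\<open>'a set\<close>,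
  since HOL cannot quantify over index types. The choice does not matter: merging the
  functions that belong to the same set of the cover turns a partition with any index type
  into one indexed by the sets of the cover, see \<open>exact_metricI\<close> and \<open>equi_exactI\<close>.
  The sums of differences always converge, see \<open>partition_of_unity_diff_summable\<close>, so
  \<^const>\<open>infsum\<close> does not take its default value there.\<close>

definition exact_metric :: "'a metric \<Rightarrow> bool" where
  "exact_metric m \<longleftrightarrow>
     (\<forall>R \<epsilon>. R > 0 \<longrightarrow> \<epsilon> > 0 \<longrightarrow>
       (\<exists>(I :: 'a set set) \<phi> U.
          partition_of_unity (mspace m) I \<phi> \<and>
          covers (mspace m) I U \<and>
          subordinated (mspace m) I \<phi> U \<and>
          (\<forall>x\<in>mspace m. \<forall>y\<in>mspace m. mdist m x y \<le> R \<longrightarrow>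
             (\<Sum>\<^sub>\<infinity>i\<in>I. \<bar>\<phi> i x - \<phi> i y\<bar>) \<le> \<epsilon>) \<and>
          (SUP i\<in>I. mdiameter m (U i)) < \<infinity>))"

definition equi_exact :: "'i set \<Rightarrow> ('i \<Rightarrow> 'a metric) \<Rightarrow> bool" where
  "equi_exact I m \<longleftrightarrow>
     (\<forall>R \<epsilon>. R > 0 \<longrightarrow> \<epsilon> > 0 \<longrightarrow>
       (\<exists>(J :: 'i \<Rightarrow> 'a set set) \<psi> U.
          (\<forall>i\<in>I. partition_of_unity (mspace (m i)) (J i) (\<psi> i) \<and>
                 covers (mspace (m i)) (J i) (U i) \<and>
                 subordinated (mspace (m i)) (J i) (\<psi> i) (U i)) \<and>
          (\<forall>i\<in>I. \<forall>x\<in>mspace (m i). \<forall>y\<in>mspace (m i). mdist (m i) x y \<le> R \<longrightarrow>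
             (\<Sum>\<^sub>\<infinity>j\<in>J i. \<bar>\<psi> i j x - \<psi> i j y\<bar>) \<le> \<epsilon>) \<and>
          (SUP i\<in>I. SUP j\<in>J i. mdiameter (m i) (U i j)) < \<infinity>))"

lemma partition_of_unity_diff_summable:
  assumes "partition_of_unity X I \<phi>" "x \<in> X" "y \<in> X"
  shows "(\<lambda>i. \<bar>\<phi> i x - \<phi> i y\<bar>) summable_on I"
proof (rule summable_on_comparison_test)
  show "(\<lambda>i. \<phi> i x + \<phi> i y) summable_on I"
    using assms unfolding partition_of_unity_def
    by (intro summable_on_add) (auto simp: summable_on_def)
  have nonneg: "\<phi> i z \<ge> 0" if "i \<in> I" "z \<in> X" for i z
    using assms that unfolding partition_of_unity_def by fastforce
  show "\<bar>\<phi> i x - \<phi> i y\<bar> \<le> \<phi> i x + \<phi> i y" if "i \<in> I" for i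
    using nonneg[OF that assms(2)] nonneg[OF that assms(3)] by linarith
qed auto

lemma partition_of_unity_merge:
  fixes \<phi> :: "'i \<Rightarrow> 'a \<Rightarrow> real" and U :: "'i \<Rightarrow> 'a set"
  assumes pu: "partition_of_unity X I \<phi>" and sub: "subordinated X I \<phi> U"
  defines "\<psi> \<equiv> \<lambda>A x. \<Sum>\<^sub>\<infinity>i\<in>{i\<in>I. U i = A}. \<phi> i x"
  shows "partition_of_unity X (U ` I) \<psi>"
    and "subordinated X (U ` I) \<psi> (\<lambda>A. A)"
    and "\<And>x y. x \<in> X \<Longrightarrow> y \<in> X \<Longrightarrow>
           (\<Sum>\<^sub>\<infinity>A\<in>U ` I. \<bar>\<psi> A x - \<psi> A y\<bar>) \<le> (\<Sum>\<^sub>\<infinity>i\<in>I. \<bar>\<phi> i x - \<phi> i y\<bar>)"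
proof -
  define F where "F = (\<lambda>A. {i\<in>I. U i = A})"
  have bij: "bij_betw snd (Sigma (U ` I) F) I"
    by (auto simp: bij_betw_def inj_on_def F_def image_iff)
  have psi: "\<psi> A x = infsum (\<lambda>i. \<phi> i x) (F A)" for A x
    by (simp add: \<psi>_def F_def)
  have FI: "F A \<subseteq> I" for A by (auto simp: F_def)
  have phi_sum: "((\<lambda>i. \<phi> i x) has_sum 1) I" if "x \<in> X" for x
    using pu that by (auto simp: partition_of_unity_def)
  have phi_nonneg: "\<phi> i x \<ge> 0" if "i \<in> I" "x \<in> X" for i x
    using pu that unfolding partition_of_unity_def by fastforce
  have phi_F: "(\<lambda>i. \<phi> i x) summable_on F A" if "x \<in> X" for x A
    using phi_sum[OF that] FI by (meson has_sum_imp_summable summable_on_subset_banach)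
  have psi_sum: "((\<lambda>A. \<psi> A x) has_sum 1) (U ` I)" if x: "x \<in> X" for x
  proof (rule has_sum_SigmaD)
    show "((\<lambda>p. \<phi> (snd p) x) has_sum 1) (Sigma (U ` I) F)"
      using phi_sum[OF x] has_sum_reindex_bij_betw[OF bij, of "\<lambda>i. \<phi> i x"] by simp
    show "((\<lambda>i. \<phi> (snd (A, i)) x) has_sum \<psi> A x) (F A)" for A
      using phi_F[OF x] by (simp add: psi)
  qed
  have psi_nonneg: "\<psi> A x \<ge> 0" if "x \<in> X" for A x
    unfolding psi using phi_nonneg that FI by (intro infsum_nonneg) auto
  have psi_le: "\<psi> A x \<le> 1" if "x \<in> X" for A x
    unfolding psi infsumI[OF phi_sum[OF that], symmetric]
    using phi_nonneg that FI phi_F[OF that] phi_sum[OF that]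
    by (intro infsum_mono_neutral) (auto simp: summable_on_def)
  show "partition_of_unity X (U ` I) \<psi>"
    using psi_sum psi_nonneg psi_le by (auto simp: partition_of_unity_def)
  show "subordinated X (U ` I) \<psi> (\<lambda>A. A)"
    using sub unfolding subordinated_def psi by (auto intro!: infsum_0 simp: F_def)
  fix x y assume xy: "x \<in> X" "y \<in> X"
  have s: "(\<lambda>i. \<bar>\<phi> i x - \<phi> i y\<bar>) summable_on I"
    by (rule partition_of_unity_diff_summable[OF pu xy])
  have sF: "(\<lambda>i. \<bar>\<phi> i x - \<phi> i y\<bar>) summable_on F A" for A
    using s FI summable_on_subset_banach by blast
  have hs: "((\<lambda>A. \<Sum>\<^sub>\<infinity>i\<in>F A. \<bar>\<phi> i x - \<phi> i y\<bar>) has_sum (\<Sum>\<^sub>\<infinity>i\<in>I. \<bar>\<phi> i x - \<phi> i y\<bar>)) (U ` I)"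
  proof (rule has_sum_SigmaD)
    show "((\<lambda>p. \<bar>\<phi> (snd p) x - \<phi> (snd p) y\<bar>) has_sum (\<Sum>\<^sub>\<infinity>i\<in>I. \<bar>\<phi> i x - \<phi> i y\<bar>))
            (Sigma (U ` I) F)"
      using has_sum_infsum[OF s] has_sum_reindex_bij_betw[OF bij, of "\<lambda>i. \<bar>\<phi> i x - \<phi> i y\<bar>"]
      by simp
    show "((\<lambda>i. \<bar>\<phi> (snd (A, i)) x - \<phi> (snd (A, i)) y\<bar>) has_sum
             (\<Sum>\<^sub>\<infinity>i\<in>F A. \<bar>\<phi> i x - \<phi> i y\<bar>)) (F A)" for A
      using has_sum_infsum[OF sF] by simp
  qed
  have le: "\<bar>\<psi> A x - \<psi> A y\<bar> \<le> (\<Sum>\<^sub>\<infinity>i\<in>F A. \<bar>\<phi> i x - \<phi> i y\<bar>)" for A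
  proof -
    have "\<psi> A x - \<psi> A y = (\<Sum>\<^sub>\<infinity>i\<in>F A. \<phi> i x - \<phi> i y)"
      using infsum_add[OF phi_F[OF xy(1)], of "\<lambda>i. - \<phi> i y" A] phi_F[OF xy(2)]
      by (simp add: psi infsum_uminus summable_on_uminus)
    then show ?thesis
      using norm_infsum_bound[of "\<lambda>i. \<phi> i x - \<phi> i y" "F A"] sF by simp
  qed
  have "(\<lambda>A. \<bar>\<psi> A x - \<psi> A y\<bar>) summable_on U ` I"
    by (rule summable_on_comparison_test[OF has_sum_imp_summable[OF hs]]) (use le in auto)
  then have "(\<Sum>\<^sub>\<infinity>A\<in>U ` I. \<bar>\<psi> A x - \<psi> A y\<bar>)
               \<le> (\<Sum>\<^sub>\<infinity>A\<in>U ` I. \<Sum>\<^sub>\<infinity>i\<in>F A. \<bar>\<phi> i x - \<phi> i y\<bar>)"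
    using has_sum_imp_summable[OF hs] le by (intro infsum_mono) auto
  then show "(\<Sum>\<^sub>\<infinity>A\<in>U ` I. \<bar>\<psi> A x - \<psi> A y\<bar>) \<le> (\<Sum>\<^sub>\<infinity>i\<in>I. \<bar>\<phi> i x - \<phi> i y\<bar>)"
    using infsumI[OF hs] by simp
qed

lemma exact_metricI:
  fixes m :: "'a metric"
  assumes "\<And>R \<epsilon>. R > 0 \<Longrightarrow> \<epsilon> > 0 \<Longrightarrow>
       \<exists>(I :: 'k set) \<phi> U.
          partition_of_unity (mspace m) I \<phi> \<and>
          covers (mspace m) I U \<and>
          subordinated (mspace m) I \<phi> U \<and>
          (\<forall>x\<in>mspace m. \<forall>y\<in>mspace m. mdist m x y \<le> R \<longrightarrow>
             (\<Sum>\<^sub>\<infinity>i\<in>I. \<bar>\<phi> i x - \<phi> i y\<bar>) \<le> \<epsilon>) \<and>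
          (SUP i\<in>I. mdiameter m (U i)) < \<infinity>"
  shows "exact_metric m"
  unfolding exact_metric_def
proof (intro allI impI)
  fix R \<epsilon> :: real assume "R > 0" "\<epsilon> > 0"
  from assms[OF this] obtain I :: "'k set" and \<phi> U where
    pu: "partition_of_unity (mspace m) I \<phi>" and cov: "covers (mspace m) I U" and
    sub: "subordinated (mspace m) I \<phi> U" and
    var: "\<And>x y. x \<in> mspace m \<Longrightarrow> y \<in> mspace m \<Longrightarrow> mdist m x y \<le> R \<Longrightarrow>
             (\<Sum>\<^sub>\<infinity>i\<in>I. \<bar>\<phi> i x - \<phi> i y\<bar>) \<le> \<epsilon>" and
    diam: "(SUP i\<in>I. mdiameter m (U i)) < \<infinity>"
    by blast
  note mg = partition_of_unity_merge[OF pu sub]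
  show "\<exists>(I :: 'a set set) \<phi> U.
          partition_of_unity (mspace m) I \<phi> \<and>
          covers (mspace m) I U \<and>
          subordinated (mspace m) I \<phi> U \<and>
          (\<forall>x\<in>mspace m. \<forall>y\<in>mspace m. mdist m x y \<le> R \<longrightarrow>
             (\<Sum>\<^sub>\<infinity>i\<in>I. \<bar>\<phi> i x - \<phi> i y\<bar>) \<le> \<epsilon>) \<and>
          (SUP i\<in>I. mdiameter m (U i)) < \<infinity>"
  proof (intro exI conjI ballI impI)
    show "covers (mspace m) (U ` I) (\<lambda>A. A)" using cov by (simp add: covers_def)
    show "(SUP A\<in>U ` I. mdiameter m A) < \<infinity>" using diam by (simp add: image_image)
  qed (use mg(1,2) in \<open>auto intro: order_trans[OF mg(3) var]\<close>)
qed

lemma equi_exactI: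
  fixes I :: "'i set" and m :: "'i \<Rightarrow> 'a metric"
  assumes "\<And>R \<epsilon>. R > 0 \<Longrightarrow> \<epsilon> > 0 \<Longrightarrow>
       \<exists>(J :: 'i \<Rightarrow> 'k set) \<psi> U.
          (\<forall>i\<in>I. partition_of_unity (mspace (m i)) (J i) (\<psi> i) \<and>
                 covers (mspace (m i)) (J i) (U i) \<and>
                 subordinated (mspace (m i)) (J i) (\<psi> i) (U i)) \<and>
          (\<forall>i\<in>I. \<forall>x\<in>mspace (m i). \<forall>y\<in>mspace (m i). mdist (m i) x y \<le> R \<longrightarrow>
             (\<Sum>\<^sub>\<infinity>j\<in>J i. \<bar>\<psi> i j x - \<psi> i j y\<bar>) \<le> \<epsilon>) \<and>
          (SUP i\<in>I. SUP j\<in>J i. mdiameter (m i) (U i j)) < \<infinity>"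
  shows "equi_exact I m"
  unfolding equi_exact_def
proof (intro allI impI)
  fix R \<epsilon> :: real assume "R > 0" "\<epsilon> > 0"
  from assms[OF this] obtain J :: "'i \<Rightarrow> 'k set" and \<psi> U where
    pu: "\<And>i. i \<in> I \<Longrightarrow> partition_of_unity (mspace (m i)) (J i) (\<psi> i)" and
    cov: "\<And>i. i \<in> I \<Longrightarrow> covers (mspace (m i)) (J i) (U i)" and
    sub: "\<And>i. i \<in> I \<Longrightarrow> subordinated (mspace (m i)) (J i) (\<psi> i) (U i)" and
    var: "\<And>i x y. i \<in> I \<Longrightarrow> x \<in> mspace (m i) \<Longrightarrow> y \<in> mspace (m i) \<Longrightarrow> mdist (m i) x y \<le> R \<Longrightarrow>
             (\<Sum>\<^sub>\<infinity>j\<in>J i. \<bar>\<psi> i j x - \<psi> i j y\<bar>) \<le> \<epsilon>" and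
    diam: "(SUP i\<in>I. SUP j\<in>J i. mdiameter (m i) (U i j)) < \<infinity>"
    by blast
  note mg = partition_of_unity_merge[OF pu sub]
  show "\<exists>(J :: 'i \<Rightarrow> 'a set set) \<psi> U.
          (\<forall>i\<in>I. partition_of_unity (mspace (m i)) (J i) (\<psi> i) \<and>
                 covers (mspace (m i)) (J i) (U i) \<and>
                 subordinated (mspace (m i)) (J i) (\<psi> i) (U i)) \<and>
          (\<forall>i\<in>I. \<forall>x\<in>mspace (m i). \<forall>y\<in>mspace (m i). mdist (m i) x y \<le> R \<longrightarrow>
             (\<Sum>\<^sub>\<infinity>j\<in>J i. \<bar>\<psi> i j x - \<psi> i j y\<bar>) \<le> \<epsilon>) \<and>
          (SUP i\<in>I. SUP j\<in>J i. mdiameter (m i) (U i j)) < \<infinity>"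
  proof (rule exI[of _ "\<lambda>i. U i ` J i"],
         rule exI[of _ "\<lambda>i A x. \<Sum>\<^sub>\<infinity>j\<in>{j\<in>J i. U i j = A}. \<psi> i j x"],
         rule exI[of _ "\<lambda>i A. A"], intro conjI ballI impI)
    show "covers (mspace (m i)) (U i ` J i) (\<lambda>A. A)" if "i \<in> I" for i
      using cov[OF that] by (simp add: covers_def)
    show "(SUP i\<in>I. SUP A\<in>U i ` J i. mdiameter (m i) A) < \<infinity>"
      using diam by (simp add: image_image)
  qed (use mg(1,2) in \<open>auto intro: order_trans[OF mg(3) var]\<close>)
qed

end

theory Submission
  imports Defs
begin

text \<open>Refine a partition \<open>\<phi>\<close> with variation at most \<open>\<epsilon>/2\<close>, subordinated to an equi-exact
  cover, by partitions \<open>\<psi> i\<close> of the members of the cover with variation at most \<open>\<epsilon>/2\<close>: the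
  products \<open>\<phi> i * \<psi> i j\<close>, extended by \<open>0\<close>, work. The jump of the extension at the boundary of
  \<open>U i\<close> is harmless, for if \<open>x \<in> U i\<close> but \<open>y \<notin> U i\<close>, then \<open>\<phi> i y = 0\<close>, so the products
  contribute \<open>\<phi> i x = \<bar>\<phi> i x - \<phi> i y\<bar>\<close>.\<close>

definition refine_pu ::
    "('i \<Rightarrow> 'a set) \<Rightarrow> ('i \<Rightarrow> 'a \<Rightarrow> real) \<Rightarrow> ('i \<Rightarrow> 'j \<Rightarrow> 'a \<Rightarrow> real) \<Rightarrow> 'i \<times> 'j \<Rightarrow> 'a \<Rightarrow> real" where
  "refine_pu U \<phi> \<psi> = (\<lambda>(i, j) x. if x \<in> U i then \<phi> i x * \<psi> i j x else 0)"

lemma refine_pu_apply: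
  "refine_pu U \<phi> \<psi> (i, j) x = (if x \<in> U i then \<phi> i x * \<psi> i j x else 0)"
  by (simp add: refine_pu_def)

lemma partition_of_unity_nonneg:
  "partition_of_unity X I \<phi> \<Longrightarrow> i \<in> I \<Longrightarrow> x \<in> X \<Longrightarrow> 0 \<le> \<phi> i x"
  by (fastforce simp: partition_of_unity_def)

lemma partition_of_unity_le_1:
  "partition_of_unity X I \<phi> \<Longrightarrow> i \<in> I \<Longrightarrow> x \<in> X \<Longrightarrow> \<phi> i x \<le> 1"
  by (fastforce simp: partition_of_unity_def)

lemma partition_of_unity_has_sum:
  "partition_of_unity X I \<phi> \<Longrightarrow> x \<in> X \<Longrightarrow> ((\<lambda>i. \<phi> i x) has_sum 1) I"
  by (simp add: partition_of_unity_def)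

text \<open>On \<open>U i\<close> the factor \<open>\<phi> i x\<close> comes out of a sum with value
  1; off \<open>U i\<close> it is 0 by subordination. So splitting \<open>\<phi> i\<close> into
  products loses no mass, even at points where \<open>\<psi> i\<close> is unconstrained.\<close>

lemma has_sum_refine_pu:
  assumes sub: "subordinated X I \<phi> U" and i: "i \<in> I" and x: "x \<in> X"
    and pu: "partition_of_unity (U i) (J i) (\<psi> i)"
  shows "((\<lambda>j. refine_pu U \<phi> \<psi> (i, j) x) has_sum \<phi> i x) (J i)"
proof (cases "x \<in> U i")
  case True
  show ?thesis
    using has_sum_cmult_right[OF partition_of_unity_has_sum[OF pu True], of "\<phi> i x"] True
    by (simp add: refine_pu_apply)
next
  case False
  then have "\<phi> i x = 0" using sub i x by (auto simp: subordinated_def)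
  with False show ?thesis by (simp add: refine_pu_apply)
qed

text \<open>Summing over the pairs fibre by fibre gives first \<open>\<phi> i x\<close>, by
  \<open>has_sum_refine_pu\<close>, and then 1.\<close>

lemma partition_of_unity_refine:
  assumes pu: "partition_of_unity X I \<phi>" and sub: "subordinated X I \<phi> U"
    and U: "\<And>i. i \<in> I \<Longrightarrow> U i \<subseteq> X"
    and pu': "\<And>i. i \<in> I \<Longrightarrow> partition_of_unity (U i) (J i) (\<psi> i)"
  shows "partition_of_unity X (Sigma I J) (refine_pu U \<phi> \<psi>)"
proof -
  have bounds: "refine_pu U \<phi> \<psi> (i, j) x \<in> {0..1}" if "i \<in> I" "j \<in> J i" "x \<in> X" for i j x
    using partition_of_unity_nonneg[OF pu that(1,3)] partition_of_unity_le_1[OF pu that(1,3)]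
      partition_of_unity_nonneg[OF pu'[OF that(1)] that(2)]
      partition_of_unity_le_1[OF pu'[OF that(1)] that(2)]
    by (auto simp: refine_pu_apply intro!: mult_le_one)
  have "((\<lambda>p. refine_pu U \<phi> \<psi> p x) has_sum 1) (Sigma I J)" if x: "x \<in> X" for x
  proof (rule has_sum_SigmaI)
    show inner: "((\<lambda>j. refine_pu U \<phi> \<psi> (i, j) x) has_sum \<phi> i x) (J i)" if "i \<in> I" for i
      by (rule has_sum_refine_pu[where J = J and \<psi> = \<psi>, OF sub that x pu'[OF that]])
    show outer: "((\<lambda>i. \<phi> i x) has_sum 1) I"
      by (rule partition_of_unity_has_sum[OF pu x])
    \<comment> \<open>Iterated sums alone do not give summability over the pairs; nonnegativity of
      the terms does.\<close>
    show "(\<lambda>p. refine_pu U \<phi> \<psi> p x) summable_on Sigma I J"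
      by (rule summable_on_SigmaI[OF inner has_sum_imp_summable[OF outer]])
        (use bounds x in auto)
  qed
  with bounds show ?thesis by (auto simp: partition_of_unity_def)
qed

lemma subordinated_refine:
  assumes sub: "\<And>i. i \<in> I \<Longrightarrow> subordinated (U i) (J i) (\<psi> i) (V i)"
  shows "subordinated X (Sigma I J) (refine_pu U \<phi> \<psi>) (\<lambda>(i, j). V i j)"
  using sub by (auto simp: subordinated_def refine_pu_apply)

text \<open>The first term pays for the change of \<open>\<phi> i\<close>, the second for that of
  \<open>\<psi> i\<close>. The weight \<open>\<phi> i y\<close> allows a later summation over
  \<open>i\<close>: a bare \<open>\<delta>\<close> for each \<open>i\<close> could add up without
  limit.\<close>

lemma refine_pu_variation_fibre:
  assumes pu: "partition_of_unity X I \<phi>" and sub: "subordinated X I \<phi> U" and i: "i \<in> I"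
    and pu': "partition_of_unity (U i) (J i) (\<psi> i)"
    and x: "x \<in> X" and y: "y \<in> X" and "0 \<le> \<delta>"
    and var: "x \<in> U i \<Longrightarrow> y \<in> U i \<Longrightarrow> (\<Sum>\<^sub>\<infinity>j\<in>J i. \<bar>\<psi> i j x - \<psi> i j y\<bar>) \<le> \<delta>"
  shows "(\<Sum>\<^sub>\<infinity>j\<in>J i. \<bar>refine_pu U \<phi> \<psi> (i, j) x - refine_pu U \<phi> \<psi> (i, j) y\<bar>)
           \<le> \<bar>\<phi> i x - \<phi> i y\<bar> + \<phi> i y * \<delta>"
proof -
  have nonneg: "0 \<le> \<phi> i z" if "z \<in> X" for z
    by (rule partition_of_unity_nonneg[OF pu i that])
  have nonneg': "0 \<le> \<psi> i j z" if "z \<in> U i" "j \<in> J i" for z j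
    by (rule partition_of_unity_nonneg[OF pu' that(2,1)])
  have outside: "\<phi> i z = 0" if "z \<in> X" "z \<notin> U i" for z
    using sub i that by (auto simp: subordinated_def)
  have sum: "(\<Sum>\<^sub>\<infinity>j\<in>J i. refine_pu U \<phi> \<psi> (i, j) z) = \<phi> i z" if "z \<in> X" for z
    by (rule infsumI[OF has_sum_refine_pu[where J = J and \<psi> = \<psi>, OF sub i that pu']])
  have abs_refine: "\<bar>refine_pu U \<phi> \<psi> (i, j) z\<bar> = refine_pu U \<phi> \<psi> (i, j) z"
    if "z \<in> X" "j \<in> J i" for j z
    using nonneg[OF that(1)] nonneg'[OF _ that(2)] by (simp add: refine_pu_apply)
  show ?thesis
  proof (cases "x \<in> U i \<and> y \<in> U i")
    case True
    then have xU: "x \<in> U i" and yU: "y \<in> U i" by auto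
    have summ: "(\<lambda>j. \<bar>\<psi> i j x - \<psi> i j y\<bar>) summable_on J i"
      by (rule partition_of_unity_diff_summable[OF pu' xU yU])
    \<comment> \<open>The \<open>\<psi> i j x\<close> sum to 1 over \<open>j\<close>, so the change
      of \<open>\<phi> i\<close> is counted once, however large \<open>J i\<close> is.\<close>
    have bound: "((\<lambda>j. \<bar>\<phi> i x - \<phi> i y\<bar> * \<psi> i j x + \<phi> i y * \<bar>\<psi> i j x - \<psi> i j y\<bar>) has_sum
        (\<bar>\<phi> i x - \<phi> i y\<bar> * 1 + \<phi> i y * (\<Sum>\<^sub>\<infinity>j\<in>J i. \<bar>\<psi> i j x - \<psi> i j y\<bar>))) (J i)"
      by (intro has_sum_add has_sum_cmult_right partition_of_unity_has_sum[OF pu' xU]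
          has_sum_infsum summ)
    have le: "\<bar>refine_pu U \<phi> \<psi> (i, j) x - refine_pu U \<phi> \<psi> (i, j) y\<bar>
        \<le> \<bar>\<phi> i x - \<phi> i y\<bar> * \<psi> i j x + \<phi> i y * \<bar>\<psi> i j x - \<psi> i j y\<bar>" if j: "j \<in> J i" for j
    proof -
      \<comment> \<open>Add and subtract \<open>\<phi> i y * \<psi> i j x\<close>.\<close>
      have "refine_pu U \<phi> \<psi> (i, j) x - refine_pu U \<phi> \<psi> (i, j) y
          = (\<phi> i x - \<phi> i y) * \<psi> i j x + \<phi> i y * (\<psi> i j x - \<psi> i j y)"
        using xU yU by (simp add: refine_pu_apply algebra_simps)
      also have "\<bar>\<dots>\<bar> \<le> \<bar>(\<phi> i x - \<phi> i y) * \<psi> i j x\<bar> + \<bar>\<phi> i y * (\<psi> i j x - \<psi> i j y)\<bar>"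
        by (rule abs_triangle_ineq)
      finally show ?thesis
        using nonneg[OF y] nonneg'[OF xU j] by (simp add: abs_mult)
    qed
    have "(\<Sum>\<^sub>\<infinity>j\<in>J i. \<bar>refine_pu U \<phi> \<psi> (i, j) x - refine_pu U \<phi> \<psi> (i, j) y\<bar>)
        \<le> (\<Sum>\<^sub>\<infinity>j\<in>J i. \<bar>\<phi> i x - \<phi> i y\<bar> * \<psi> i j x + \<phi> i y * \<bar>\<psi> i j x - \<psi> i j y\<bar>)"
      using has_sum_imp_summable[OF bound] le
      by (intro infsum_mono) (auto intro: summable_on_comparison_test)
    also have "\<dots> \<le> \<bar>\<phi> i x - \<phi> i y\<bar> + \<phi> i y * \<delta>"
      using infsumI[OF bound] mult_left_mono[OF var[OF xU yU] nonneg[OF y]] by simp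
    finally show ?thesis .
  next
    case False
    then consider "x \<notin> U i" | "y \<notin> U i" by blast
    \<comment> \<open>All products at the point outside \<open>U i\<close> vanish, and those at the
      other point are nonnegative. The absolute values thus drop out, and \<open>sum\<close>
      evaluates what is left.\<close>
    then have "(\<Sum>\<^sub>\<infinity>j\<in>J i. \<bar>refine_pu U \<phi> \<psi> (i, j) x - refine_pu U \<phi> \<psi> (i, j) y\<bar>)
        = \<bar>\<phi> i x - \<phi> i y\<bar>"
    proof cases
      case 1
      then have "(\<Sum>\<^sub>\<infinity>j\<in>J i. \<bar>refine_pu U \<phi> \<psi> (i, j) x - refine_pu U \<phi> \<psi> (i, j) y\<bar>)
          = (\<Sum>\<^sub>\<infinity>j\<in>J i. refine_pu U \<phi> \<psi> (i, j) y)"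
        using abs_refine[OF y] by (intro infsum_cong) (simp add: refine_pu_apply[of U \<phi> \<psi> i _ x])
      with 1 show ?thesis using sum[OF y] outside[OF x] nonneg[OF y] by simp
    next
      case 2
      then have "(\<Sum>\<^sub>\<infinity>j\<in>J i. \<bar>refine_pu U \<phi> \<psi> (i, j) x - refine_pu U \<phi> \<psi> (i, j) y\<bar>)
          = (\<Sum>\<^sub>\<infinity>j\<in>J i. refine_pu U \<phi> \<psi> (i, j) x)"
        using abs_refine[OF x] by (intro infsum_cong) (simp add: refine_pu_apply[of U \<phi> \<psi> i _ y])
      with 2 show ?thesis using sum[OF x] outside[OF y] nonneg[OF x] by simp
    qed
    then show ?thesis using nonneg[OF y] \<open>0 \<le> \<delta>\<close> by simp
  qed
qed

text \<open>Sum the fibre bounds over \<open>I\<close>: since the \<open>\<phi> i y\<close> sum to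
  1, the terms \<open>\<phi> i y * \<delta>\<close> contribute just \<open>\<delta>\<close> in
  all.\<close>

lemma refine_pu_variation:
  assumes pu: "partition_of_unity X I \<phi>" and sub: "subordinated X I \<phi> U"
    and U: "\<And>i. i \<in> I \<Longrightarrow> U i \<subseteq> X"
    and pu': "\<And>i. i \<in> I \<Longrightarrow> partition_of_unity (U i) (J i) (\<psi> i)"
    and x: "x \<in> X" and y: "y \<in> X" and "0 \<le> \<delta>"
    and var: "\<And>i. i \<in> I \<Longrightarrow> x \<in> U i \<Longrightarrow> y \<in> U i \<Longrightarrow>
                (\<Sum>\<^sub>\<infinity>j\<in>J i. \<bar>\<psi> i j x - \<psi> i j y\<bar>) \<le> \<delta>"
  shows "(\<Sum>\<^sub>\<infinity>p\<in>Sigma I J. \<bar>refine_pu U \<phi> \<psi> p x - refine_pu U \<phi> \<psi> p y\<bar>)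
           \<le> (\<Sum>\<^sub>\<infinity>i\<in>I. \<bar>\<phi> i x - \<phi> i y\<bar>) + \<delta>"
proof -
  let ?D = "\<lambda>i j. \<bar>refine_pu U \<phi> \<psi> (i, j) x - refine_pu U \<phi> \<psi> (i, j) y\<bar>"
  \<comment> \<open>The refined family is itself a partition of unity, so its differences are
    summable over the pairs. This justifies both the iterated sum and the summability of the fibre
    sums over \<open>I\<close>.\<close>
  have "(\<lambda>p. \<bar>refine_pu U \<phi> \<psi> p x - refine_pu U \<phi> \<psi> p y\<bar>) summable_on Sigma I J"
    by (rule partition_of_unity_diff_summable[OF partition_of_unity_refine[OF pu sub U pu'] x y])
  then have summ: "(\<lambda>(i, j). ?D i j) summable_on Sigma I J"
    by (simp add: case_prod_unfold)
  have bound: "((\<lambda>i. \<bar>\<phi> i x - \<phi> i y\<bar> + \<phi> i y * \<delta>) has_sum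
      ((\<Sum>\<^sub>\<infinity>i\<in>I. \<bar>\<phi> i x - \<phi> i y\<bar>) + 1 * \<delta>)) I"
    by (intro has_sum_add has_sum_cmult_left partition_of_unity_has_sum[OF pu y]
        has_sum_infsum partition_of_unity_diff_summable[OF pu x y])
  have "(\<Sum>\<^sub>\<infinity>p\<in>Sigma I J. \<bar>refine_pu U \<phi> \<psi> p x - refine_pu U \<phi> \<psi> p y\<bar>)
      = (\<Sum>\<^sub>\<infinity>i\<in>I. \<Sum>\<^sub>\<infinity>j\<in>J i. ?D i j)"
    using infsum_Sigma'_banach[OF summ] by (simp add: case_prod_unfold)
  also have "\<dots> \<le> (\<Sum>\<^sub>\<infinity>i\<in>I. \<bar>\<phi> i x - \<phi> i y\<bar> + \<phi> i y * \<delta>)"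
    by (intro infsum_mono summable_on_Sigma_banach[OF summ] has_sum_imp_summable[OF bound]
        refine_pu_variation_fibre[OF pu sub _ pu' x y \<open>0 \<le> \<delta>\<close> var])
  also have "\<dots> = (\<Sum>\<^sub>\<infinity>i\<in>I. \<bar>\<phi> i x - \<phi> i y\<bar>) + \<delta>"
    using infsumI[OF bound] by simp
  finally show ?thesis .
qed

text \<open>\<open>mdiameter\<close> depends on the metric only through \<open>mdist\<close>, which
  \<open>submetric\<close> keeps. Diameter bounds found inside the members of the cover thus hold in
  the whole space.\<close>

lemma mdiameter_submetric [simp]: "mdiameter (submetric m S) = mdiameter m"
  by (simp add: mdiameter_def fun_eq_iff)

theorem theorem3p1:
  fixes X :: "'a metric"
  assumes "\<And>R \<epsilon>. R > 0 \<Longrightarrow> \<epsilon> > 0 \<Longrightarrow>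
    \<exists>(I :: 'i set) \<phi> U.
       partition_of_unity (mspace X) I \<phi> \<and>
       (\<forall>x\<in>mspace X. \<forall>y\<in>mspace X. mdist X x y \<le> R \<longrightarrow>
          (\<Sum>\<^sub>\<infinity>i\<in>I. \<bar>\<phi> i x - \<phi> i y\<bar>) \<le> \<epsilon>) \<and>
       covers (mspace X) I U \<and>
       subordinated (mspace X) I \<phi> U \<and>
       equi_exact I (\<lambda>i. submetric X (U i))"
  shows "exact_metric X"
proof (rule exact_metricI)
  fix R \<epsilon> :: real assume R: "R > 0" and "\<epsilon> > 0"
  then have \<epsilon>: "\<epsilon> / 2 > 0" by simp
  obtain I :: "'i set" and \<phi> U where
    pu: "partition_of_unity (mspace X) I \<phi>" and
    var: "\<And>x y. x \<in> mspace X \<Longrightarrow> y \<in> mspace X \<Longrightarrow> mdist X x y \<le> R \<Longrightarrow>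
            (\<Sum>\<^sub>\<infinity>i\<in>I. \<bar>\<phi> i x - \<phi> i y\<bar>) \<le> \<epsilon> / 2" and
    cov: "covers (mspace X) I U" and
    sub: "subordinated (mspace X) I \<phi> U" and
    equi: "equi_exact I (\<lambda>i. submetric X (U i))"
    using assms[OF R \<epsilon>] by blast
  have U: "U i \<subseteq> mspace X" if "i \<in> I" for i
    using cov that by (auto simp: covers_def)
  \<comment> \<open>In general \<open>submetric\<close> has the carrier
    \<open>mspace X \<inter> U i\<close>.\<close>
  then have space: "mspace (submetric X (U i)) = U i" if "i \<in> I" for i
    using that by auto
  \<comment> \<open>The induced metrics keep distances, so the same \<open>R\<close> serves.
    Equi-exactness, as opposed to exactness of each member, supplies one bound on the diameters of
    all \<open>V i j\<close>.\<close>
  obtain J :: "'i \<Rightarrow> 'a set set" and \<psi> V where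
    all: "\<forall>i\<in>I. partition_of_unity (mspace (submetric X (U i))) (J i) (\<psi> i) \<and>
            covers (mspace (submetric X (U i))) (J i) (V i) \<and>
            subordinated (mspace (submetric X (U i))) (J i) (\<psi> i) (V i)" and
    var_all: "\<forall>i\<in>I. \<forall>x\<in>mspace (submetric X (U i)). \<forall>y\<in>mspace (submetric X (U i)).
                mdist (submetric X (U i)) x y \<le> R \<longrightarrow>
                (\<Sum>\<^sub>\<infinity>j\<in>J i. \<bar>\<psi> i j x - \<psi> i j y\<bar>) \<le> \<epsilon> / 2" and
    diam: "(SUP i\<in>I. SUP j\<in>J i. mdiameter (submetric X (U i)) (V i j)) < \<infinity>"
    using equi R \<epsilon> unfolding equi_exact_def by blast
  have pu': "partition_of_unity (U i) (J i) (\<psi> i)" and cov': "covers (U i) (J i) (V i)"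
    and sub': "subordinated (U i) (J i) (\<psi> i) (V i)" if "i \<in> I" for i
    using all that space[OF that] by auto
  have var': "(\<Sum>\<^sub>\<infinity>j\<in>J i. \<bar>\<psi> i j x - \<psi> i j y\<bar>) \<le> \<epsilon> / 2"
    if "i \<in> I" "x \<in> U i" "y \<in> U i" "mdist X x y \<le> R" for i x y
    using var_all that space[OF that(1)] by auto
  \<comment> \<open>The refined partition is indexed by pairs, which \<open>exact_metricI\<close>
    admits as an index type.\<close>
  show "\<exists>(K :: ('i \<times> 'a set) set) \<theta> W.
          partition_of_unity (mspace X) K \<theta> \<and>
          covers (mspace X) K W \<and>
          subordinated (mspace X) K \<theta> W \<and>
          (\<forall>x\<in>mspace X. \<forall>y\<in>mspace X. mdist X x y \<le> R \<longrightarrow>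
             (\<Sum>\<^sub>\<infinity>k\<in>K. \<bar>\<theta> k x - \<theta> k y\<bar>) \<le> \<epsilon>) \<and>
          (SUP k\<in>K. mdiameter X (W k)) < \<infinity>"
  proof (intro exI conjI ballI impI)
    show "partition_of_unity (mspace X) (Sigma I J) (refine_pu U \<phi> \<psi>)"
      by (rule partition_of_unity_refine[OF pu sub U pu'])
    have "(\<Union>p\<in>Sigma I J. case p of (i, j) \<Rightarrow> V i j) = (\<Union>i\<in>I. \<Union>j\<in>J i. V i j)"
      by auto
    also have "\<dots> = mspace X" using cov cov' by (simp add: covers_def)
    finally show "covers (mspace X) (Sigma I J) (\<lambda>(i, j). V i j)" by (simp add: covers_def)
    show "subordinated (mspace X) (Sigma I J) (refine_pu U \<phi> \<psi>) (\<lambda>(i, j). V i j)"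
      by (rule subordinated_refine[OF sub'])
    show "(\<Sum>\<^sub>\<infinity>p\<in>Sigma I J. \<bar>refine_pu U \<phi> \<psi> p x - refine_pu U \<phi> \<psi> p y\<bar>) \<le> \<epsilon>"
      if "x \<in> mspace X" "y \<in> mspace X" "mdist X x y \<le> R" for x y
      using refine_pu_variation[OF pu sub U pu' that(1,2) less_imp_le[OF \<epsilon>] var'] that(3)
        var[OF that] by force
    \<comment> \<open>The supremum over pairs is the nested supremum that \<open>diam\<close>
      bounds.\<close>
    have "(SUP p\<in>Sigma I J. mdiameter X (case p of (i, j) \<Rightarrow> V i j))
        = (SUP i\<in>I. SUP j\<in>J i. mdiameter X (V i j))"
      by (rule antisym) (auto intro!: SUP_least intro: SUP_upper2)
    with diam show "(SUP p\<in>Sigma I J. mdiameter X (case p of (i, j) \<Rightarrow> V i j)) < \<infinity>"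
      by simp
  qed
qed

end
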